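(* Let $A\in\mathbb{R}^{n\times n}$ and $b\in\mathbb{R}^n$, and suppose that $\operatorname{sym}(A)\succeq(1+m)I$ for some $m>0$. Let $x^*$ be the unique solution of $\Phi(x):=Ax-|x|-b=0$ (which exists under this hypothesis). Let $0<\rho<1$, $\epsilon>0$, $x^0\in\mathbb{R}^n$, and let $(x^k)$ be the iterates of the CPPC method described in the context, with constants $\alpha$ and $C_R$ as defined there. Put $$\eta:=\frac{\alpha m^2}{C_R^2}.$$ Then $\eta\in(0,1)$ and, for every $k\ge0$, $$\|x^{k+1}-x^*\|^2\le(1-\eta)\|x^k-x^*\|^2.$$ Consequently, $x^k\to x^*$ from every starting point $x^0\in\mathbb{R}^n$, and the residual $\Phi(x^k)$ converges to zero R-linearly, i.e. there exist $C\ge0$ and $q\in(0,1)$ with $\|\Phi(x^k)\|\le Cq^k$ for all $k\ge0$.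
   Context: $|x|$ is the componentwise absolute value; $\langle\cdot,\cdot\rangle$, $\|\cdot\|$ are the Euclidean inner product and norm; $e_i$ is the $i$th coordinate vector; $\operatorname{sym}(A)=(A+A^\top)/2$; $I$ is the identity; $M\succeq N$ means $M-N$ is positive semidefinite. For $t\in\mathbb{R}$ put $t^-=\max\{-t,0\}$ and $g(t)=(t^-)^2$. Let $F(x)=(A-I)x-b$. Given $0<\rho<1$ and $\epsilon>0$, set $\ell_i=\max\{a_{ii}-1,\epsilon\}$ and $\gamma_i=\rho/\ell_i$ for $i=1,\dots,n$. For $\gamma>0$ and $z\in\mathbb{R}$, $\operatorname{prox}_{\gamma g}(z)=\arg\min_{t\in\mathbb{R}}\{g(t)+(2\gamma)^{-1}|t-z|^2\}$; explicitly, $\operatorname{prox}_{\gamma g}(z)=z$ if $z\ge0$ and $z/(1+2\gamma)$ if $z<0$. The coordinate proximal residual is $R(x)=(R_i(x))_{i=1}^n$ with $R_i(x)=\gamma_i^{-1}\bigl[x_i-\operatorname{prox}_{\gamma_i g}(x_i-\gamma_iF_i(x))\bigr]$. CPPC method: from an arbitrary $x^0\in\mathbb{R}^n$, for $k=0,1,2,\dots$: choose any $i_k\in\arg\max_{1\le i\le n}|R_i(x^k)|$. If $R_{i_k}(x^k)=0$, terminate and return $x^k$. Otherwise define $y^k$ by $y^k_j=x^k_j$ for $j\ne i_k$ and $y^k_{i_k}=\operatorname{prox}_{\gamma_{i_k}g}(x^k_{i_k}-\gamma_{i_k}F_{i_k}(x^k))$; set $d^k=x^k-y^k$, $v^k=\Phi(y^k)$,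 $\lambda_k=\langle v^k,d^k\rangle/\|v^k\|^2$, and $x^{k+1}=x^k-\lambda_kv^k$. If the method terminates at $x^k$, set $x^j=x^k$ for all $j>k$. Constants: $C_R=\bigl(\sum_{i=1}^n(1+2\gamma_i)^2\bigr)^{1/2}$, $C_S=\max_i\gamma_i(\|Ae_i\|+1)$, $C_\Phi=C_R+C_S$, $\gamma_*=\min_i\gamma_i$, $\alpha=(1-\rho)^2\gamma_*^2/C_\Phi^2$. *)

theory Defs
  imports "HOL-Analysis.Analysis"
begin

definition sym_part :: "real^'n^'n \<Rightarrow> real^'n^'n" where
  "sym_part A = (1 / 2) *\<^sub>R (A + transpose A)"

definition pos_semidef :: "real^'n^'n \<Rightarrow> bool" where
  "pos_semidef M \<longleftrightarrow> transpose M = M \<and> (\<forall>x. 0 \<le> x \<bullet> (M *v x))"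

definition loewner_ge :: "real^'n^'n \<Rightarrow> real^'n^'n \<Rightarrow> bool" where
  "loewner_ge M N \<longleftrightarrow> pos_semidef (M - N)"

text \<open>On \<open>real^'n\<close> the library's absolute value is the componentwise one (\<open>abs_vec_def\<close>).\<close>

definition Phi :: "real^'n^'n \<Rightarrow> real^'n \<Rightarrow> real^'n \<Rightarrow> real^'n" where
  "Phi A b x = A *v x - \<bar>x\<bar> - b"

definition F_map :: "real^'n^'n \<Rightarrow> real^'n \<Rightarrow> real^'n \<Rightarrow> real^'n" where
  "F_map A b x = (A - mat 1) *v x - b"

definition neg_part :: "real \<Rightarrow> real" where
  "neg_part t = max (- t) 0"

definition g_fun :: "real \<Rightarrow> real" where
  "g_fun t = (neg_part t)\<^sup>2"

definition prox :: "real \<Rightarrow> (real \<Rightarrow> real) \<Rightarrow> real \<Rightarrow> real" where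
  "prox \<gamma> g z = (ARG_MIN (\<lambda>t. g t + inverse (2 * \<gamma>) * \<bar>t - z\<bar>\<^sup>2) t. True)"

definition ell :: "real^'n^'n \<Rightarrow> real \<Rightarrow> 'n \<Rightarrow> real" where
  "ell A \<epsilon> i = max (A $ i $ i - 1) \<epsilon>"

definition gam :: "real^'n^'n \<Rightarrow> real \<Rightarrow> real \<Rightarrow> 'n \<Rightarrow> real" where
  "gam A \<rho> \<epsilon> i = \<rho> / ell A \<epsilon> i"

definition prox_point ::
  "real^'n^'n \<Rightarrow> real^'n \<Rightarrow> real \<Rightarrow> real \<Rightarrow> real^'n \<Rightarrow> 'n \<Rightarrow> real" where
  "prox_point A b \<rho> \<epsilon> x i =
     prox (gam A \<rho> \<epsilon> i) g_fun (x $ i - gam A \<rho> \<epsilon> i * F_map A b x $ i)"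

definition residual ::
  "real^'n^'n \<Rightarrow> real^'n \<Rightarrow> real \<Rightarrow> real \<Rightarrow> real^'n \<Rightarrow> real^'n" where
  "residual A b \<rho> \<epsilon> x =
     (\<chi> i. inverse (gam A \<rho> \<epsilon> i) * (x $ i - prox_point A b \<rho> \<epsilon> x i))"

definition cppc_update ::
  "real^'n^'n \<Rightarrow> real^'n \<Rightarrow> real \<Rightarrow> real \<Rightarrow> real^'n \<Rightarrow> 'n \<Rightarrow> real^'n" where
  "cppc_update A b \<rho> \<epsilon> x i =
     (let y = (\<chi> j. if j = i then prox_point A b \<rho> \<epsilon> x i else x $ j);
          d = x - y;
          v = Phi A b y;
          lam = (v \<bullet> d) / (norm v)\<^sup>2
      in x - lam *\<^sub>R v)"

text \<open>
  The index is any maximiser of the residual, so this is a relation. Termination at \<open>x\<close> is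
  encoded by repeating \<open>x\<close>: a vanishing maximal residual vanishes for every choice of index,
  so all later iterates equal \<open>x\<close> as well.
\<close>

definition cppc_step ::
  "real^'n^'n \<Rightarrow> real^'n \<Rightarrow> real \<Rightarrow> real \<Rightarrow> real^'n \<Rightarrow> real^'n \<Rightarrow> bool" where
  "cppc_step A b \<rho> \<epsilon> x x' \<longleftrightarrow>
     (\<exists>i. is_arg_max (\<lambda>j. \<bar>residual A b \<rho> \<epsilon> x $ j\<bar>) (\<lambda>_. True) i \<and>
          x' = (if residual A b \<rho> \<epsilon> x $ i = 0 then x else cppc_update A b \<rho> \<epsilon> x i))"

definition cppc_iterates ::
  "real^'n^'n \<Rightarrow> real^'n \<Rightarrow> real \<Rightarrow> real \<Rightarrow> real^'n \<Rightarrow> (nat \<Rightarrow> real^'n) \<Rightarrow> bool" where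
  "cppc_iterates A b \<rho> \<epsilon> x0 x \<longleftrightarrow>
     x 0 = x0 \<and> (\<forall>k. cppc_step A b \<rho> \<epsilon> (x k) (x (Suc k)))"

definition C_R :: "real^'n^'n \<Rightarrow> real \<Rightarrow> real \<Rightarrow> real" where
  "C_R A \<rho> \<epsilon> = sqrt (\<Sum>i\<in>UNIV. (1 + 2 * gam A \<rho> \<epsilon> i)\<^sup>2)"

definition C_S :: "real^'n^'n \<Rightarrow> real \<Rightarrow> real \<Rightarrow> real" where
  "C_S A \<rho> \<epsilon> = (MAX i. gam A \<rho> \<epsilon> i * (norm (A *v axis i 1) + 1))"

definition C_Phi :: "real^'n^'n \<Rightarrow> real \<Rightarrow> real \<Rightarrow> real" where
  "C_Phi A \<rho> \<epsilon> = C_R A \<rho> \<epsilon> + C_S A \<rho> \<epsilon>"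

definition gam_min :: "real^'n^'n \<Rightarrow> real \<Rightarrow> real \<Rightarrow> real" where
  "gam_min A \<rho> \<epsilon> = (MIN i. gam A \<rho> \<epsilon> i)"

definition alpha :: "real^'n^'n \<Rightarrow> real \<Rightarrow> real \<Rightarrow> real" where
  "alpha A \<rho> \<epsilon> = (1 - \<rho>)\<^sup>2 * (gam_min A \<rho> \<epsilon>)\<^sup>2 / (C_Phi A \<rho> \<epsilon>)\<^sup>2"

text \<open>The minimiser defining \<open>prox\<close> of \<open>g_fun\<close> exists, is unique and has the expected closed form.\<close>

lemma is_arg_min_prox_g_fun:
  assumes "\<gamma> > 0"
  shows "is_arg_min (\<lambda>t. g_fun t + inverse (2 * \<gamma>) * \<bar>t - z\<bar>\<^sup>2) (\<lambda>_. True) s \<longleftrightarrow>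
         s = (if z \<ge> 0 then z else z / (1 + 2 * \<gamma>))"
proof -
  define f where "f t = g_fun t + inverse (2 * \<gamma>) * \<bar>t - z\<bar>\<^sup>2" for t
  define p where "p = (if z \<ge> 0 then z else z / (1 + 2 * \<gamma>))"
  have less: "f p + inverse (2 * \<gamma>) * (t - p)\<^sup>2 \<le> f t" for t
  proof (cases "z \<ge> 0")
    case True
    then show ?thesis by (simp add: f_def p_def g_fun_def neg_part_def)
  next
    case False
    have z: "z = p * (1 + 2 * \<gamma>)" and p: "p < 0"
      using False assms by (auto simp: p_def divide_simps)
    have "inverse (2 * \<gamma>) * (t - z)\<^sup>2 =
        inverse (2 * \<gamma>) * (t - p)\<^sup>2 - 2 * p * (t - p) + inverse (2 * \<gamma>) * (p - z)\<^sup>2"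
      unfolding z using assms by (simp add: field_simps power2_eq_square)
    moreover have "p\<^sup>2 + 2 * p * (t - p) \<le> g_fun t"
    proof (cases "t \<le> 0")
      case True
      have "0 \<le> (t - p)\<^sup>2" by simp
      then show ?thesis using True
        by (simp add: g_fun_def neg_part_def power2_eq_square algebra_simps)
    next
      case False
      then have "p * t \<le> 0" using p by (simp add: mult_nonpos_nonneg)
      moreover have "0 \<le> p * p" by simp
      ultimately have "2 * (p * t) \<le> p * p" by linarith
      then show ?thesis using False
        by (simp add: g_fun_def neg_part_def power2_eq_square right_diff_distrib mult.commute mult.left_commute)
    qed
    moreover have "g_fun p = p\<^sup>2" using p by (simp add: g_fun_def neg_part_def)
    ultimately show ?thesis unfolding f_def power2_abs by linarith
  qed
  have "f p < f t" if "t \<noteq> p" for t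
  proof -
    have "0 < inverse (2 * \<gamma>) * (t - p)\<^sup>2" using assms that by simp
    then show ?thesis using less[of t] by linarith
  qed
  then have "is_arg_min f (\<lambda>_. True) s \<longleftrightarrow> s = p"
    unfolding is_arg_min_linorder by (metis order.refl less_le_not_le)
  then show ?thesis by (simp add: f_def[abs_def] p_def)
qed

lemma prox_g_fun:
  assumes "\<gamma> > 0"
  shows "prox \<gamma> g_fun z = (if z \<ge> 0 then z else z / (1 + 2 * \<gamma>))"
  unfolding prox_def arg_min_def is_arg_min_prox_g_fun[OF assms] by simp

lemma cppc_iterates_exist: "\<exists>x. cppc_iterates A b \<rho> \<epsilon> x0 x"
proof -
  have "\<exists>x'. cppc_step A b \<rho> \<epsilon> x x'" for x
  proof -
    let ?r = "\<lambda>j. \<bar>residual A b \<rho> \<epsilon> x $ j\<bar>"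
    have "Max (range ?r) \<in> range ?r" by (intro Max_in) auto
    then obtain i where i: "Max (range ?r) = ?r i" by (rule imageE)
    have "\<forall>j. ?r j \<le> ?r i" unfolding i[symmetric] by (intro allI Max_ge) auto
    then have "is_arg_max ?r (\<lambda>_. True) i" by (auto simp: is_arg_max_linorder)
    then show ?thesis unfolding cppc_step_def by blast
  qed
  then have "\<exists>f. \<forall>x. cppc_step A b \<rho> \<epsilon> x (f x)" by (intro choice allI)
  then obtain f where f: "\<And>x. cppc_step A b \<rho> \<epsilon> x (f x)" by blast
  have "cppc_iterates A b \<rho> \<epsilon> x0 (\<lambda>k. (f ^^ k) x0)"
    by (simp add: cppc_iterates_def f)
  then show ?thesis by blast
qed

end

theory Submission
  imports Defs
begin

text \<open>
  Componentwise \<open>\<Phi> = F + g'\<close> with \<open>g'(t) = - 2 t\<^sup>-\<close>, and \<open>\<Phi>\<close> is strongly monotone with modulus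
  \<open>m\<close>. The optimality condition of the proximal step reads \<open>R\<^sub>i(x) = F\<^sub>i(x) + g'(p\<^sub>i)\<close> with \<open>p\<^sub>i\<close>
  the proximal point, so the largest residual \<open>r\<close> controls \<open>\<Phi>(x)\<close>, hence the distance to the
  solution. For \<open>v = \<Phi>(y)\<close>, monotonicity makes \<open>{z. \<langle>v, z - y\<rangle> \<le> 0}\<close> a half-space containing
  the solution, and the update is the projection of \<open>x\<close> onto it. It therefore decreases the
  squared distance by \<open>\<langle>v, x - y\<rangle>\<^sup>2 / \<parallel>v\<parallel>\<^sup>2\<close>, which is at least \<open>\<alpha> r\<^sup>2\<close>.
\<close>

section \<open>Zeros of strongly monotone Lipschitz maps\<close>

text \<open>Banach's theorem applied to \<open>x - t *\<^sub>R f x\<close>, whose fixed points for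
  \<open>t > 0\<close> are the zeros of \<open>f\<close>. Expanding the square, monotonicity bounds
  the cross term and the Lipschitz bound the last one. Uniqueness needs monotonicity alone.\<close>

lemma strongly_monotone_lipschitz_unique_zero:
  fixes f :: "'a::{real_inner, banach} \<Rightarrow> 'a"
  assumes "m > 0"
    and mono: "\<And>x y. m * (norm (x - y))\<^sup>2 \<le> (f x - f y) \<bullet> (x - y)"
    and lip: "\<And>x y. norm (f x - f y) \<le> L * norm (x - y)"
  shows "\<exists>!z. f z = 0"
proof -
  \<comment> \<open>Enlarging the Lipschitz constant to at least \<open>m\<close> makes
    \<open>K\<close> positive and \<open>1 - m^2/K^2\<close> nonnegative, as the division and the
    square root below require.\<close>
  define K where "K = max L m"
  have K: "K > 0" "m \<le> K" using \<open>m > 0\<close> by (auto simp: K_def)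
  have lipK: "norm (f x - f y) \<le> K * norm (x - y)" for x y
    using lip[of x y] mult_right_mono[of L K "norm (x - y)"] by (auto simp: K_def)
  \<comment> \<open>This step size minimises the squared factor \<open>1 - 2*t*m + t^2*K^2\<close>;
    the minimum is \<open>1 - m^2/K^2\<close>.\<close>
  define t where "t = m / K\<^sup>2"
  define c where "c = sqrt (1 - m\<^sup>2 / K\<^sup>2)"
  have "m\<^sup>2 \<le> K\<^sup>2" using K \<open>m > 0\<close> by (simp add: power_mono)
  then have ratio: "0 < m\<^sup>2 / K\<^sup>2" "m\<^sup>2 / K\<^sup>2 \<le> 1" using K \<open>m > 0\<close> by auto
  then have c: "0 \<le> c" "c < 1" by (auto simp: c_def)
  have c2: "c\<^sup>2 = 1 - m\<^sup>2 / K\<^sup>2" using ratio by (simp add: c_def)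
  have t: "t > 0" using K \<open>m > 0\<close> by (simp add: t_def)
  define T where "T x = x - t *\<^sub>R f x" for x
  have contr: "dist (T x) (T y) \<le> c * dist x y" for x y
  proof -
    have "(norm (T x - T y))\<^sup>2 =
        (norm (x - y))\<^sup>2 - 2 * t * ((f x - f y) \<bullet> (x - y)) + t\<^sup>2 * (norm (f x - f y))\<^sup>2"
      unfolding T_def power2_norm_eq_inner
      by (simp add: inner_diff_left inner_diff_right inner_commute power2_eq_square algebra_simps)
    also have "\<dots> \<le> (norm (x - y))\<^sup>2 - 2 * t * (m * (norm (x - y))\<^sup>2)
        + t\<^sup>2 * (K * norm (x - y))\<^sup>2"
      using mono[of x y] lipK[of x y] t
      by (intro add_mono diff_mono mult_left_mono power_mono) auto
    also have "\<dots> = (1 - m\<^sup>2 / K\<^sup>2) * (norm (x - y))\<^sup>2"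
      using K by (simp add: t_def field_simps power2_eq_square)
    also have "\<dots> = (c * norm (x - y))\<^sup>2" by (simp add: power_mult_distrib c2)
    finally have "norm (T x - T y) \<le> c * norm (x - y)"
      by (rule power2_le_imp_le) (simp add: c)
    then show ?thesis by (simp add: dist_norm)
  qed
  obtain z where "T z = z"
    using banach_fix_type[OF c, of T] contr by blast
  then have z: "f z = 0" using t by (simp add: T_def)
  have "w = z" if "f w = 0" for w
  proof -
    have "m * (norm (w - z))\<^sup>2 \<le> 0" using mono[of w z] that z by simp
    then show ?thesis using \<open>m > 0\<close> by (simp add: mult_le_0_iff)
  qed
  then show ?thesis using z by blast
qed

section \<open>Monotonicity and Lipschitz estimates for \<open>Phi\<close>\<close>

lemma norm_vec_abs_diff_le:
  fixes x y :: "real^'n"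
  shows "norm (\<bar>x\<bar> - \<bar>y\<bar>) \<le> norm (x - y)"
  by (rule norm_le_componentwise_cart) (simp add: abs_vec_def abs_triangle_ineq3)

text \<open>\<open>A\<close> and its transpose have the same quadratic form. This carries the
  hypothesis on \<open>sym_part A\<close> over to \<open>A\<close> itself.\<close>

lemma inner_sym_part: "x \<bullet> (sym_part A *v x) = x \<bullet> (A *v x)"
proof -
  have "x \<bullet> (transpose A *v x) = x \<bullet> (A *v x)"
    by (metis dot_lmul_matrix inner_commute matrix_vector_mul_linear transpose_matrix_vector)
  then show ?thesis
    by (simp add: sym_part_def scaleR_matrix_vector_assoc[symmetric]
        matrix_vector_mult_add_rdistrib inner_add_right)
qed

lemma loewner_ge_sym_partD:
  assumes "loewner_ge (sym_part A) (c *\<^sub>R mat 1)"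
  shows "c * (norm x)\<^sup>2 \<le> x \<bullet> (A *v x)"
proof -
  have "0 \<le> x \<bullet> ((sym_part A - c *\<^sub>R mat 1) *v x)"
    using assms by (simp add: loewner_ge_def pos_semidef_def)
  also have "\<dots> = x \<bullet> (A *v x) - c * (norm x)\<^sup>2"
    by (simp add: matrix_vector_mult_diff_rdistrib inner_diff_right inner_sym_part
        scaleR_matrix_vector_assoc[symmetric] power2_norm_eq_inner)
  finally show ?thesis by simp
qed

lemma diagonal_ge_of_loewner:
  fixes A :: "real^'n^'n"
  assumes "loewner_ge (sym_part A) (c *\<^sub>R mat 1)"
  shows "c \<le> A $ i $ i"
  using loewner_ge_sym_partD[OF assms, of "axis i 1"]
  by (simp add: inner_axis' matrix_vector_mult_basis column_def)

lemma Phi_diff: "Phi A b x - Phi A b y = A *v (x - y) - (\<bar>x\<bar> - \<bar>y\<bar>)"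
  unfolding Phi_def matrix_vector_mult_diff_distrib by simp

text \<open>The linear part contributes at least \<open>1 + m\<close>; the absolute value, being
  1-Lipschitz, takes away at most 1.\<close>

lemma Phi_strongly_monotone:
  fixes A :: "real^'n^'n"
  assumes "loewner_ge (sym_part A) ((1 + m) *\<^sub>R mat 1)"
  shows "m * (norm (x - y))\<^sup>2 \<le> (Phi A b x - Phi A b y) \<bullet> (x - y)"
proof -
  have "(\<bar>x\<bar> - \<bar>y\<bar>) \<bullet> (x - y) \<le> norm (\<bar>x\<bar> - \<bar>y\<bar>) * norm (x - y)"
    by (rule norm_cauchy_schwarz)
  also have "\<dots> \<le> (norm (x - y))\<^sup>2"
    unfolding power2_eq_square by (intro mult_right_mono norm_vec_abs_diff_le) auto
  finally have abs_part: "(\<bar>x\<bar> - \<bar>y\<bar>) \<bullet> (x - y) \<le> (norm (x - y))\<^sup>2" .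
  have "(Phi A b x - Phi A b y) \<bullet> (x - y) =
      (x - y) \<bullet> (A *v (x - y)) - (\<bar>x\<bar> - \<bar>y\<bar>) \<bullet> (x - y)"
    unfolding Phi_diff inner_diff_left[of "A *v (x - y)"] by (simp only: inner_commute)
  then show ?thesis
    using loewner_ge_sym_partD[OF assms, of "x - y"] abs_part by (simp add: algebra_simps)
qed

text \<open>The term \<open>A *v (x - y)\<close> is not replaced by an operator norm bound: when
  \<open>x - y\<close> is a multiple of \<open>axis i 1\<close>, it gives the column norm that
  occurs in \<open>C_S\<close>.\<close>

lemma norm_Phi_diff_le:
  "norm (Phi A b x - Phi A b y) \<le> norm (A *v (x - y)) + norm (x - y)"
  using norm_triangle_ineq4[of "A *v (x - y)" "\<bar>x\<bar> - \<bar>y\<bar>"] norm_vec_abs_diff_le[of x y]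
  by (simp add: Phi_diff)

lemma Phi_lipschitz:
  "norm (Phi A b x - Phi A b y) \<le> (onorm ((*v) A) + 1) * norm (x - y)"
  using norm_Phi_diff_le[of A b x y]
    onorm[OF matrix_vector_mul_bounded_linear, of A "x - y"]
  by (simp add: algebra_simps)

section \<open>The proximal residual and the constants\<close>

text \<open>Rests on \<open>|t| = t + 2 * neg_part t\<close>, the \<open>t\<close> being absorbed
  into \<open>A - mat 1\<close>.\<close>

lemma Phi_nth: "Phi A b x $ i = F_map A b x $ i - 2 * neg_part (x $ i)"
  by (simp add: Phi_def F_map_def neg_part_def matrix_vector_mult_diff_rdistrib abs_vec_def)

lemma abs_neg_part_diff_le: "\<bar>neg_part s - neg_part t\<bar> \<le> \<bar>s - t\<bar>"
  by (simp add: neg_part_def)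

text \<open>The stationarity condition \<open>g'(p) + (p - z)/\<gamma> = 0\<close> of the minimiser
  \<open>p\<close>, multiplied by \<open>\<gamma>\<close>.\<close>

lemma prox_g_fun_optimality:
  assumes "\<gamma> > 0"
  shows "prox \<gamma> g_fun z - 2 * \<gamma> * neg_part (prox \<gamma> g_fun z) = z"
proof (cases "z \<ge> 0")
  case True
  then show ?thesis by (simp add: prox_g_fun[OF assms] neg_part_def)
next
  case False
  define p where "p = z / (1 + 2 * \<gamma>)"
  have "p < 0" using False assms by (simp add: p_def divide_neg_pos)
  then have "p - 2 * \<gamma> * neg_part p = (1 + 2 * \<gamma>) * p"
    by (simp add: neg_part_def algebra_simps)
  also have "\<dots> = z" using assms by (simp add: p_def)
  finally show ?thesis using False by (simp add: prox_g_fun[OF assms] p_def)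
qed

lemma gam_pos: "0 < \<rho> \<Longrightarrow> \<epsilon> > 0 \<Longrightarrow> gam A \<rho> \<epsilon> i > 0"
  by (simp add: gam_def ell_def)

text \<open>\<open>A $ i $ i - 1\<close> is the slope of the \<open>i\<close>-th component of
  \<open>F_map\<close> along coordinate \<open>i\<close>, and \<open>ell\<close> dominates it. The
  bound leaves the factor \<open>1 - \<rho>\<close> in the descent estimate.\<close>

lemma gam_mult_diagonal_le:
  assumes "0 < \<rho>" "\<epsilon> > 0"
  shows "gam A \<rho> \<epsilon> i * (A $ i $ i - 1) \<le> \<rho>"
proof -
  have "ell A \<epsilon> i > 0" using assms by (simp add: ell_def)
  moreover have "\<rho> * (A $ i $ i - 1) \<le> \<rho> * ell A \<epsilon> i"
    using assms by (simp add: ell_def)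
  ultimately show ?thesis by (simp add: gam_def pos_divide_le_eq)
qed

lemma gam_min_le: "gam_min A \<rho> \<epsilon> \<le> gam A \<rho> \<epsilon> i"
  by (simp add: gam_min_def)

lemma gam_min_pos:
  fixes A :: "real^'n^'n"
  assumes "0 < \<rho>" "\<epsilon> > 0"
  shows "gam_min A \<rho> \<epsilon> > 0"
  using assms by (simp add: gam_min_def gam_pos)

lemma C_S_ge: "gam A \<rho> \<epsilon> i * (norm (A *v axis i 1) + 1) \<le> C_S A \<rho> \<epsilon>"
  by (simp add: C_S_def)

lemma C_R_gt_1:
  fixes A :: "real^'n^'n"
  assumes "0 < \<rho>" "\<epsilon> > 0"
  shows "C_R A \<rho> \<epsilon> > 1"
proof -
  \<comment> \<open>The index type is nonempty, and a single summand already exceeds 1.\<close>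
  obtain i :: 'n where True by simp
  have "1 < (1 + 2 * gam A \<rho> \<epsilon> i)\<^sup>2"
    using gam_pos[OF assms, of A i] by (simp add: one_less_power)
  also have "\<dots> \<le> (\<Sum>i\<in>UNIV. (1 + 2 * gam A \<rho> \<epsilon> i)\<^sup>2)"
    by (rule member_le_sum) auto
  finally show ?thesis by (simp add: C_R_def)
qed

lemma prox_point_diff:
  assumes "0 < \<rho>" "\<epsilon> > 0"
  shows "x $ i - prox_point A b \<rho> \<epsilon> x i = gam A \<rho> \<epsilon> i * residual A b \<rho> \<epsilon> x $ i"
  using gam_pos[OF assms, of A i] by (simp add: residual_def)

text \<open>Optimality of the proximal point, divided by the step size. Compared with
  \<open>Phi_nth\<close>, only the argument of \<open>neg_part\<close> changes, from
  \<open>x $ i\<close> to the proximal point.\<close>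

lemma residual_eq:
  assumes "0 < \<rho>" "\<epsilon> > 0"
  shows "residual A b \<rho> \<epsilon> x $ i = F_map A b x $ i - 2 * neg_part (prox_point A b \<rho> \<epsilon> x i)"
proof -
  let ?\<gamma> = "gam A \<rho> \<epsilon> i" and ?p = "prox_point A b \<rho> \<epsilon> x i"
  have \<gamma>: "?\<gamma> > 0" using assms by (rule gam_pos)
  have "?p - 2 * ?\<gamma> * neg_part ?p = x $ i - ?\<gamma> * F_map A b x $ i"
    unfolding prox_point_def by (rule prox_g_fun_optimality[OF \<gamma>])
  then have "x $ i - ?p = ?\<gamma> * (F_map A b x $ i - 2 * neg_part ?p)"
    by (simp add: algebra_simps)
  then show ?thesis using \<gamma> prox_point_diff[OF assms, of x i A b] by simp
qed

text \<open>By \<open>Phi_nth\<close> and \<open>residual_eq\<close>, \<open>Phi\<close> and the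
  residual differ in component \<open>j\<close> by twice a difference of negative parts, whose
  arguments are \<open>gam\<close> times the residual apart. Hence the factors
  \<open>1 + 2 * gam\<close>, whose Euclidean norm is \<open>C_R\<close>.\<close>

lemma norm_Phi_le_residual:
  fixes A :: "real^'n^'n"
  assumes "0 < \<rho>" "\<epsilon> > 0"
    and max: "\<And>j. \<bar>residual A b \<rho> \<epsilon> x $ j\<bar> \<le> r"
  shows "norm (Phi A b x) \<le> C_R A \<rho> \<epsilon> * r"
proof -
  \<comment> \<open>Any index serves here, as \<open>r\<close> bounds an absolute value.\<close>
  have "0 \<le> r" using max[of undefined] by linarith
  have comp: "(Phi A b x $ j)\<^sup>2 \<le> (1 + 2 * gam A \<rho> \<epsilon> j)\<^sup>2 * r\<^sup>2" for j
  proof -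
    let ?\<gamma> = "gam A \<rho> \<epsilon> j" and ?R = "residual A b \<rho> \<epsilon> x $ j"
      and ?p = "prox_point A b \<rho> \<epsilon> x j"
    have \<gamma>: "?\<gamma> > 0" using assms by (simp add: gam_pos)
    have "Phi A b x $ j - ?R = 2 * (neg_part ?p - neg_part (x $ j))"
      by (simp add: Phi_nth residual_eq[OF assms(1,2)])
    then have "\<bar>Phi A b x $ j - ?R\<bar> = 2 * \<bar>neg_part ?p - neg_part (x $ j)\<bar>"
      by (simp only: abs_mult abs_numeral)
    also have "\<dots> \<le> 2 * \<bar>x $ j - ?p\<bar>"
      using abs_neg_part_diff_le[of ?p "x $ j"] by (simp add: abs_minus_commute[of ?p])
    also have "\<dots> = 2 * ?\<gamma> * \<bar>?R\<bar>"
      using \<gamma> by (simp add: prox_point_diff[OF assms(1,2)] abs_mult)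
    finally have "\<bar>Phi A b x $ j\<bar> \<le> (1 + 2 * ?\<gamma>) * \<bar>?R\<bar>"
      by (simp add: algebra_simps)
    also have "\<dots> \<le> (1 + 2 * ?\<gamma>) * r"
      using \<gamma> max[of j] by (intro mult_left_mono) auto
    finally have "\<bar>Phi A b x $ j\<bar>\<^sup>2 \<le> ((1 + 2 * ?\<gamma>) * r)\<^sup>2" by (rule power_mono) simp
    then show ?thesis by (simp add: power_mult_distrib)
  qed
  have "norm (Phi A b x) = sqrt (\<Sum>j\<in>UNIV. (Phi A b x $ j)\<^sup>2)"
    by (simp add: norm_vec_def L2_set_def)
  also have "\<dots> \<le> sqrt ((\<Sum>j\<in>UNIV. (1 + 2 * gam A \<rho> \<epsilon> j)\<^sup>2) * r\<^sup>2)"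
    unfolding sum_distrib_right by (intro real_sqrt_le_mono sum_mono comp)
  also have "\<dots> = C_R A \<rho> \<epsilon> * r"
    using \<open>0 \<le> r\<close> by (simp add: real_sqrt_mult C_R_def)
  finally show ?thesis .
qed

section \<open>Projection onto a half-space and descent of one update\<close>

text \<open>The first two assumptions say that \<open>x\<close> is not interior to the half-space of
  all \<open>w\<close> with \<open>v \<bullet> (w - y) \<le> 0\<close>, and that \<open>z\<close>
  belongs to it. In the expanded square, \<open>x - z\<close> is split at \<open>y\<close>: the part
  \<open>x - y\<close> yields the decrease, and the part \<open>y - z\<close> has a favourable
  sign.\<close>

lemma norm_diff_projection_le:
  fixes x y v z :: "'a::real_inner"
  assumes "0 \<le> v \<bullet> (x - y)" and "0 \<le> v \<bullet> (y - z)" and "v \<noteq> 0"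
  shows "(norm (x - (v \<bullet> (x - y) / (norm v)\<^sup>2) *\<^sub>R v - z))\<^sup>2
    \<le> (norm (x - z))\<^sup>2 - (v \<bullet> (x - y))\<^sup>2 / (norm v)\<^sup>2"
proof -
  define l where "l = v \<bullet> (x - y) / (norm v)\<^sup>2"
  have vv: "l * (norm v)\<^sup>2 = v \<bullet> (x - y)" using assms(3) by (simp add: l_def)
  have "l \<ge> 0" using assms(1) by (simp add: l_def)
  have "(norm (x - l *\<^sub>R v - z))\<^sup>2 =
      (norm (x - z))\<^sup>2 - 2 * l * (v \<bullet> (x - z)) + l * (l * (norm v)\<^sup>2)"
    unfolding power2_norm_eq_inner
    by (simp add: inner_diff_left inner_diff_right inner_commute algebra_simps)
  also have "\<dots> = (norm (x - z))\<^sup>2 - l * (v \<bullet> (x - y)) - 2 * l * (v \<bullet> (y - z))"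
    unfolding vv by (simp add: inner_diff_right algebra_simps)
  also have "\<dots> \<le> (norm (x - z))\<^sup>2 - l * (v \<bullet> (x - y))"
    using \<open>l \<ge> 0\<close> assms(2) by simp
  also have "l * (v \<bullet> (x - y)) = (v \<bullet> (x - y))\<^sup>2 / (norm v)\<^sup>2"
    by (simp add: l_def power2_eq_square)
  finally show ?thesis by (simp add: l_def)
qed

text \<open>The decrease is \<open>(v \<bullet> (x - y))^2 / (norm v)^2\<close>. The numerator is
  bounded below through the single changed coordinate, the denominator above by \<open>C_Phi\<close>
  times the residual.\<close>

lemma cppc_update_descent:
  fixes A :: "real^'n^'n"
  assumes "m > 0" and A: "loewner_ge (sym_part A) ((1 + m) *\<^sub>R mat 1)"
    and \<rho>: "0 < \<rho>" "\<rho> < 1" and \<epsilon>: "\<epsilon> > 0"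
    and z: "Phi A b z = 0"
    and max: "\<And>j. \<bar>residual A b \<rho> \<epsilon> x $ j\<bar> \<le> \<bar>residual A b \<rho> \<epsilon> x $ i\<bar>"
    and nz: "residual A b \<rho> \<epsilon> x $ i \<noteq> 0"
  shows "(norm (cppc_update A b \<rho> \<epsilon> x i - z))\<^sup>2
    \<le> (norm (x - z))\<^sup>2 - alpha A \<rho> \<epsilon> * (residual A b \<rho> \<epsilon> x $ i)\<^sup>2"
proof -
  define r where "r = residual A b \<rho> \<epsilon> x $ i"
  define \<gamma> where "\<gamma> = gam A \<rho> \<epsilon> i"
  define y where "y = (\<chi> j. if j = i then prox_point A b \<rho> \<epsilon> x i else x $ j)"
  define v where "v = Phi A b y"
  have r: "r \<noteq> 0" using nz by (simp add: r_def)
  have \<gamma>: "\<gamma> > 0" using \<rho> \<epsilon> by (simp add: \<gamma>_def gam_pos)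
  \<comment> \<open>Only coordinate \<open>i\<close> moves, so only \<open>v $ i\<close> enters
    \<open>v \<bullet> (x - y)\<close>.\<close>
  have d: "x - y = (\<gamma> * r) *\<^sub>R axis i 1"
    by (simp add: vec_eq_iff y_def axis_def \<gamma>_def r_def prox_point_diff[OF \<rho>(1) \<epsilon>])
  have "F_map A b x $ i - F_map A b y $ i = ((A - mat 1) *v (x - y)) $ i"
    unfolding F_map_def matrix_vector_mult_diff_distrib by simp
  also have "\<dots> = \<gamma> * r * (A $ i $ i - 1)"
    unfolding d
    by (simp add: matrix_vector_mult_scaleR matrix_vector_mult_basis column_def mat_def)
  finally have "F_map A b y $ i = F_map A b x $ i - \<gamma> * r * (A $ i $ i - 1)" by simp
  \<comment> \<open>Since \<open>y $ i\<close> is the proximal point, \<open>r\<close> and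
    \<open>v $ i\<close> contain the same negative part; their difference is just the change of
    \<open>F_map\<close>.\<close>
  moreover have "r = F_map A b x $ i - 2 * neg_part (y $ i)"
    using residual_eq[OF \<rho>(1) \<epsilon>, of A b x i] by (simp add: r_def y_def)
  ultimately have "v $ i = r - \<gamma> * r * (A $ i $ i - 1)"
    by (simp only: v_def Phi_nth)
  then have "v \<bullet> (x - y) = \<gamma> * r * (r - \<gamma> * r * (A $ i $ i - 1))"
    unfolding d by (simp add: inner_axis)
  also have "\<dots> = \<gamma> * r\<^sup>2 * (1 - \<gamma> * (A $ i $ i - 1))"
    by (simp add: power2_eq_square algebra_simps)
  finally have "v \<bullet> (x - y) = \<gamma> * r\<^sup>2 * (1 - \<gamma> * (A $ i $ i - 1))" .
  moreover have "\<gamma> * (A $ i $ i - 1) \<le> \<rho>"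
    unfolding \<gamma>_def using \<rho>(1) \<epsilon> by (rule gam_mult_diagonal_le)
  ultimately have vd: "v \<bullet> (x - y) \<ge> \<gamma> * r\<^sup>2 * (1 - \<rho>)"
    using \<gamma> by (simp add: mult_left_mono)
  have pos: "\<gamma> * r\<^sup>2 * (1 - \<rho>) > 0" using \<gamma> r \<rho> by simp
  then have v: "v \<noteq> 0" using vd by auto
  \<comment> \<open>Passing from \<open>x\<close> to \<open>y\<close> costs \<open>C_S\<close>, and
    \<open>Phi\<close> at \<open>x\<close> costs \<open>C_R\<close>; together they form
    \<open>C_Phi\<close>.\<close>
  have "norm (v - Phi A b x) \<le> norm (A *v (x - y)) + norm (x - y)"
    unfolding v_def using norm_Phi_diff_le[of A b x y] by (simp add: norm_minus_commute)
  also have "\<dots> = \<gamma> * (norm (A *v axis i 1) + 1) * \<bar>r\<bar>"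
    unfolding d using \<gamma> by (simp add: matrix_vector_mult_scaleR abs_mult algebra_simps)
  also have "\<dots> \<le> C_S A \<rho> \<epsilon> * \<bar>r\<bar>"
    unfolding \<gamma>_def by (intro mult_right_mono C_S_ge) simp
  finally have "norm (v - Phi A b x) \<le> C_S A \<rho> \<epsilon> * \<bar>r\<bar>" .
  moreover have "norm (Phi A b x) \<le> C_R A \<rho> \<epsilon> * \<bar>r\<bar>"
    unfolding r_def using \<rho>(1) \<epsilon> max by (rule norm_Phi_le_residual)
  ultimately have vC: "norm v \<le> C_Phi A \<rho> \<epsilon> * \<bar>r\<bar>"
    using norm_triangle_sub[of v "Phi A b x"] by (simp add: C_Phi_def algebra_simps)
  have "0 < C_Phi A \<rho> \<epsilon> * \<bar>r\<bar>" using vC v by (meson less_le_trans zero_less_norm_iff)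
  then have C: "C_Phi A \<rho> \<epsilon> > 0" by (simp add: zero_less_mult_iff)
  \<comment> \<open>\<open>alpha\<close> is the quotient of the two squared bounds, with
    \<open>gam_min\<close> in place of \<open>\<gamma>\<close> so that it does not depend on the
    chosen index.\<close>
  have "alpha A \<rho> \<epsilon> * r\<^sup>2 = (gam_min A \<rho> \<epsilon> * r\<^sup>2 * (1 - \<rho>))\<^sup>2 / (C_Phi A \<rho> \<epsilon> * \<bar>r\<bar>)\<^sup>2"
    unfolding alpha_def power_mult_distrib power2_abs
    using r C by (simp add: power2_eq_square field_simps)
  also have "\<dots> \<le> (v \<bullet> (x - y))\<^sup>2 / (norm v)\<^sup>2"
  proof (intro frac_le power_mono vC)
    have "gam_min A \<rho> \<epsilon> * r\<^sup>2 * (1 - \<rho>) \<le> \<gamma> * r\<^sup>2 * (1 - \<rho>)"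
      using \<rho> gam_min_le[of A \<rho> \<epsilon> i] by (intro mult_right_mono) (auto simp: \<gamma>_def)
    then show "gam_min A \<rho> \<epsilon> * r\<^sup>2 * (1 - \<rho>) \<le> v \<bullet> (x - y)" using vd by linarith
    show "0 \<le> gam_min A \<rho> \<epsilon> * r\<^sup>2 * (1 - \<rho>)"
      using gam_min_pos[OF \<rho>(1) \<epsilon>, of A] \<rho> by simp
  qed (use v in auto)
  finally have decrease: "alpha A \<rho> \<epsilon> * r\<^sup>2 \<le> (v \<bullet> (x - y))\<^sup>2 / (norm v)\<^sup>2" .
  \<comment> \<open>Monotonicity between \<open>y\<close> and the zero \<open>z\<close> places the
    solution in the half-space.\<close>
  have "0 \<le> m * (norm (y - z))\<^sup>2" using \<open>m > 0\<close> by simp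
  also have "\<dots> \<le> v \<bullet> (y - z)"
    using Phi_strongly_monotone[OF A, of y z b] z by (simp add: v_def)
  finally have "(norm (x - (v \<bullet> (x - y) / (norm v)\<^sup>2) *\<^sub>R v - z))\<^sup>2
      \<le> (norm (x - z))\<^sup>2 - (v \<bullet> (x - y))\<^sup>2 / (norm v)\<^sup>2"
    using norm_diff_projection_le[of v x y z] vd pos v by simp
  moreover have "cppc_update A b \<rho> \<epsilon> x i = x - (v \<bullet> (x - y) / (norm v)\<^sup>2) *\<^sub>R v"
    by (simp add: cppc_update_def Let_def v_def y_def)
  ultimately show ?thesis using decrease by (simp add: r_def)
qed

section \<open>Error bound and linear convergence\<close>

lemma Phi_error_bound:
  fixes A :: "real^'n^'n"
  assumes "loewner_ge (sym_part A) ((1 + m) *\<^sub>R mat 1)" and "Phi A b z = 0"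
  shows "m * norm (x - z) \<le> norm (Phi A b x)"
proof (cases "x = z")
  case False
  have "m * norm (x - z) * norm (x - z) \<le> norm (Phi A b x) * norm (x - z)"
    using Phi_strongly_monotone[OF assms(1), of x z b] assms(2)
      norm_cauchy_schwarz[of "Phi A b x" "x - z"]
    by (simp add: power2_eq_square mult.assoc)
  then show ?thesis using False by simp
qed simp

text \<open>The error bound and \<open>norm_Phi_le_residual\<close> give
  \<open>m * norm (x - z) \<le> C_R * |r|\<close>, which turns the decrease
  \<open>alpha * r^2\<close> into a fixed fraction of the squared distance.\<close>

lemma cppc_step_contraction:
  fixes A :: "real^'n^'n"
  assumes "m > 0" and A: "loewner_ge (sym_part A) ((1 + m) *\<^sub>R mat 1)"
    and \<rho>: "0 < \<rho>" "\<rho> < 1" and \<epsilon>: "\<epsilon> > 0"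
    and z: "Phi A b z = 0"
    and step: "cppc_step A b \<rho> \<epsilon> x x'"
  shows "(norm (x' - z))\<^sup>2 \<le> (1 - alpha A \<rho> \<epsilon> * m\<^sup>2 / (C_R A \<rho> \<epsilon>)\<^sup>2) * (norm (x - z))\<^sup>2"
proof -
  obtain i where max: "\<And>j. \<bar>residual A b \<rho> \<epsilon> x $ j\<bar> \<le> \<bar>residual A b \<rho> \<epsilon> x $ i\<bar>"
    and x': "x' = (if residual A b \<rho> \<epsilon> x $ i = 0 then x else cppc_update A b \<rho> \<epsilon> x i)"
    using step unfolding cppc_step_def is_arg_max_linorder by auto
  define r where "r = residual A b \<rho> \<epsilon> x $ i"
  have C: "C_R A \<rho> \<epsilon> > 0" using C_R_gt_1[OF \<rho>(1) \<epsilon>, of A] by simp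
  have "m * norm (x - z) \<le> norm (Phi A b x)" using A z by (rule Phi_error_bound)
  also have "\<dots> \<le> C_R A \<rho> \<epsilon> * \<bar>r\<bar>"
    unfolding r_def using \<rho>(1) \<epsilon> max by (rule norm_Phi_le_residual)
  finally have bound: "m * norm (x - z) \<le> C_R A \<rho> \<epsilon> * \<bar>r\<bar>" .
  show ?thesis
  proof (cases "r = 0")
    \<comment> \<open>A vanishing maximal residual forces \<open>x = z\<close>, so at termination
      both sides are zero.\<close>
    case True
    then have "x = z" using bound \<open>m > 0\<close> by (simp add: mult_le_0_iff)
    then show ?thesis using x' True by (simp add: r_def)
  next
    case False
    have "(m * norm (x - z))\<^sup>2 \<le> (C_R A \<rho> \<epsilon> * \<bar>r\<bar>)\<^sup>2"
      using bound \<open>m > 0\<close> by (intro power_mono) auto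
    then have "m\<^sup>2 * (norm (x - z))\<^sup>2 / (C_R A \<rho> \<epsilon>)\<^sup>2 \<le> r\<^sup>2"
      using C by (simp add: power_mult_distrib pos_divide_le_eq mult.commute)
    then have "alpha A \<rho> \<epsilon> * (m\<^sup>2 * (norm (x - z))\<^sup>2 / (C_R A \<rho> \<epsilon>)\<^sup>2) \<le> alpha A \<rho> \<epsilon> * r\<^sup>2"
      by (intro mult_left_mono) (simp_all add: alpha_def)
    moreover have "(norm (x' - z))\<^sup>2 \<le> (norm (x - z))\<^sup>2 - alpha A \<rho> \<epsilon> * r\<^sup>2"
      using cppc_update_descent[OF \<open>m > 0\<close> A \<rho> \<epsilon> z max] False x' by (simp add: r_def)
    ultimately show ?thesis by (simp add: algebra_simps)
  qed
qed

text \<open>The quantity is the square of \<open>(1 - \<rho>) * gam_min * m / (C_Phi * C_R)\<close>,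
  so it suffices to place this quotient strictly between 0 and 1.\<close>

lemma contraction_factor_bounds:
  fixes A :: "real^'n^'n"
  assumes "m > 0" and A: "loewner_ge (sym_part A) ((1 + m) *\<^sub>R mat 1)"
    and \<rho>: "0 < \<rho>" "\<rho> < 1" and \<epsilon>: "\<epsilon> > 0"
  shows "0 < alpha A \<rho> \<epsilon> * m\<^sup>2 / (C_R A \<rho> \<epsilon>)\<^sup>2" and "alpha A \<rho> \<epsilon> * m\<^sup>2 / (C_R A \<rho> \<epsilon>)\<^sup>2 < 1"
proof -
  let ?g = "gam_min A \<rho> \<epsilon>"
  obtain i :: 'n where True by simp
  have g: "?g > 0" using \<rho>(1) \<epsilon> by (rule gam_min_pos)
  have CR: "C_R A \<rho> \<epsilon> > 1" using \<rho>(1) \<epsilon> by (rule C_R_gt_1)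
  \<comment> \<open>Diagonal entries are at least \<open>1 + m\<close>, so \<open>m\<close> is
    bounded by a column norm. This puts \<open>gam_min * m\<close> below \<open>C_S\<close>, and
    strictly below \<open>C_Phi\<close> because \<open>C_R\<close> is positive.\<close>
  have "m \<le> (A *v axis i 1) $ i"
    using diagonal_ge_of_loewner[OF A, of i] by (simp add: matrix_vector_mult_basis column_def)
  also have "\<dots> \<le> norm (A *v axis i 1)"
    using component_le_norm_cart[of "A *v axis i 1" i] by linarith
  finally have "?g * m \<le> gam A \<rho> \<epsilon> i * (norm (A *v axis i 1) + 1)"
    using g gam_min_le[of A \<rho> \<epsilon> i] \<open>m > 0\<close> by (intro mult_mono) auto
  also have "\<dots> \<le> C_S A \<rho> \<epsilon>" by (rule C_S_ge)
  finally have "?g * m < C_Phi A \<rho> \<epsilon>" using CR by (simp add: C_Phi_def)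
  moreover have gm: "0 < ?g * m" using g \<open>m > 0\<close> by simp
  ultimately have CPhi: "C_Phi A \<rho> \<epsilon> > 0" and "?g * m < C_Phi A \<rho> \<epsilon>" by auto
  moreover have "(1 - \<rho>) * (?g * m) \<le> 1 * (?g * m)"
    using \<rho> gm by (intro mult_right_mono) auto
  moreover have "C_Phi A \<rho> \<epsilon> * 1 \<le> C_Phi A \<rho> \<epsilon> * C_R A \<rho> \<epsilon>"
    using CPhi CR by (intro mult_left_mono) auto
  ultimately have "(1 - \<rho>) * (?g * m) < C_Phi A \<rho> \<epsilon> * C_R A \<rho> \<epsilon>" by linarith
  then have "(1 - \<rho>) * (?g * m) / (C_Phi A \<rho> \<epsilon> * C_R A \<rho> \<epsilon>) < 1"
    using CPhi CR by simp
  moreover have pos: "0 < (1 - \<rho>) * (?g * m) / (C_Phi A \<rho> \<epsilon> * C_R A \<rho> \<epsilon>)"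
    using \<rho> gm CPhi CR by simp
  ultimately have "((1 - \<rho>) * (?g * m) / (C_Phi A \<rho> \<epsilon> * C_R A \<rho> \<epsilon>))\<^sup>2 < 1"
    by (simp add: power_less_one_iff)
  moreover have "alpha A \<rho> \<epsilon> * m\<^sup>2 / (C_R A \<rho> \<epsilon>)\<^sup>2 =
      ((1 - \<rho>) * (?g * m) / (C_Phi A \<rho> \<epsilon> * C_R A \<rho> \<epsilon>))\<^sup>2"
    by (simp add: alpha_def power_mult_distrib power_divide)
  ultimately show "0 < alpha A \<rho> \<epsilon> * m\<^sup>2 / (C_R A \<rho> \<epsilon>)\<^sup>2" "alpha A \<rho> \<epsilon> * m\<^sup>2 / (C_R A \<rho> \<epsilon>)\<^sup>2 < 1"
    using pos by auto
qed

lemma geometric_bound_of_sq_contraction: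
  fixes x :: "nat \<Rightarrow> 'a::real_normed_vector"
  assumes "c \<ge> 0" and "\<And>k. (norm (x (Suc k) - z))\<^sup>2 \<le> c * (norm (x k - z))\<^sup>2"
  shows "norm (x k - z) \<le> norm (x 0 - z) * sqrt c ^ k"
proof (induction k)
  case (Suc k)
  have "(norm (x (Suc k) - z))\<^sup>2 \<le> (sqrt c * norm (x k - z))\<^sup>2"
    using assms by (simp add: power_mult_distrib)
  then have "norm (x (Suc k) - z) \<le> sqrt c * norm (x k - z)"
    by (rule power2_le_imp_le) (simp add: assms(1))
  also have "\<dots> \<le> sqrt c * (norm (x 0 - z) * sqrt c ^ k)"
    by (intro mult_left_mono Suc.IH) (simp add: assms(1))
  finally show ?case by (simp add: mult_ac)
qed simp

theorem theorem4p5: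
  fixes A :: "real^'n^'n" and b xstar :: "real^'n" and m \<rho> \<epsilon> \<eta> :: real
  assumes "m > 0" and "loewner_ge (sym_part A) ((1 + m) *\<^sub>R mat 1)"
    and "0 < \<rho>" and "\<rho> < 1" and "\<epsilon> > 0"
    and "xstar = (THE z. Phi A b z = 0)"
    and "\<eta> = alpha A \<rho> \<epsilon> * m\<^sup>2 / (C_R A \<rho> \<epsilon>)\<^sup>2"
  shows "(\<exists>!z. Phi A b z = 0) \<and> 0 < \<eta> \<and> \<eta> < 1 \<and>
    (\<forall>x0 x. cppc_iterates A b \<rho> \<epsilon> x0 x \<longrightarrow>
       (\<forall>k. (norm (x (Suc k) - xstar))\<^sup>2 \<le> (1 - \<eta>) * (norm (x k - xstar))\<^sup>2) \<and>
       x \<longlonglongrightarrow> xstar \<and>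
       (\<exists>C q. 0 \<le> C \<and> 0 < q \<and> q < 1 \<and> (\<forall>k. norm (Phi A b (x k)) \<le> C * q ^ k)))"
proof -
  have unique: "\<exists>!z. Phi A b z = 0"
    using assms(1) Phi_strongly_monotone[OF assms(2)] Phi_lipschitz
    by (rule strongly_monotone_lipschitz_unique_zero)
  then have zero: "Phi A b xstar = 0" unfolding assms(6) by (rule theI')
  have \<eta>: "0 < \<eta>" "\<eta> < 1"
    unfolding assms(7) using contraction_factor_bounds[OF assms(1-5)] by auto
  \<comment> \<open>The contraction concerns squared distances, hence the square root in the
    rate.\<close>
  define q where "q = sqrt (1 - \<eta>)"
  have q: "0 < q" "q < 1" using \<eta> by (auto simp: q_def)
  have "(\<forall>k. (norm (x (Suc k) - xstar))\<^sup>2 \<le> (1 - \<eta>) * (norm (x k - xstar))\<^sup>2) \<and>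
       x \<longlonglongrightarrow> xstar \<and>
       (\<exists>C q. 0 \<le> C \<and> 0 < q \<and> q < 1 \<and> (\<forall>k. norm (Phi A b (x k)) \<le> C * q ^ k))"
    if "cppc_iterates A b \<rho> \<epsilon> x0 x" for x0 x
  proof (intro conjI allI exI)
    show contr: "(norm (x (Suc k) - xstar))\<^sup>2 \<le> (1 - \<eta>) * (norm (x k - xstar))\<^sup>2" for k
      unfolding assms(7) using that
      by (intro cppc_step_contraction[OF assms(1-5) zero]) (simp add: cppc_iterates_def)
    have geo: "norm (x k - xstar) \<le> norm (x 0 - xstar) * q ^ k" for k
      unfolding q_def using \<eta> contr by (intro geometric_bound_of_sq_contraction) auto
    have "(\<lambda>k. norm (x 0 - xstar) * q ^ k) \<longlonglongrightarrow> 0"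
      using q by (intro tendsto_mult_right_zero LIMSEQ_realpow_zero) auto
    then have "(\<lambda>k. x k - xstar) \<longlonglongrightarrow> 0"
      by (rule Lim_null_comparison[rotated]) (simp add: geo)
    then show "x \<longlonglongrightarrow> xstar" by (simp add: LIM_zero_iff)
    \<comment> \<open>As \<open>Phi\<close> vanishes at \<open>xstar\<close>, its Lipschitz constant
      turns the geometric bound on the distance into one on \<open>Phi\<close>, with the same rate
      \<open>q\<close>.\<close>
    let ?L = "onorm ((*v) A) + 1"
    have L: "0 \<le> ?L" using onorm_pos_le[OF matrix_vector_mul_bounded_linear, of A] by simp
    then show "0 \<le> ?L * norm (x 0 - xstar)" by simp
    show "norm (Phi A b (x k)) \<le> ?L * norm (x 0 - xstar) * q ^ k" for k
      using Phi_lipschitz[of A b "x k" xstar] zero mult_left_mono[OF geo[of k] L]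
      by (simp add: mult.assoc)
  qed (fact q)+
  then show ?thesis using unique \<eta> by blast
qed

end
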